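(* Let the positive Markov process $X$ be in $(\star_1,\star_2)$-Laplace duality with the positive Markov process $Y$ for some choice of $\star_1\in\{0^+\cdot\infty,0\cdot\infty^-\}$, $\star_2\in\{\infty\cdot0^+,\infty^-\cdot0\}$. The following are equivalent: (a) the weak limit $\nu_x:=\lim_{t\to\infty}\mathbb{P}_x(X_t\in\cdot)$ exists (as a probability on $[0,\infty]$) for all $x\in(0,\infty)$ and does not depend on $x\in(0,\infty)$; (b) for all $y\in(0,\infty)$ the weak limit $\gamma^y:=\lim_{t\to\infty}\mathbb{P}^y(Y_t\in\cdot)$ exists (as a probability on $[0,\infty]$) and is carried by $\{0,\infty\}$. When (a)-(b) are met, the Laplace transform of the common $\nu:=\nu_x$ (any $x\in(0,\infty)$) is given by $$\int e^{-yv}\,\nu(\mathrm{d}v)=\gamma^y(\{0\}),\qquad y\in(0,\infty).$$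
   Context: Positive Markov process: a time-homogeneous Markov process with values in $[0,\infty]$ (Borel $\sigma$-field), under probabilities $(\mathbb{P}_x)_{x\in[0,\infty]}$ on a common measurable space, with $x\mapsto\mathbb{P}_x(X_t\in A)$ Borel, $\mathbb{P}_x(X_0=x)=1$ and the Markov property; no path regularity is assumed. For $Y$ laws and expectations are written $\mathbb{P}^y,\mathbb{E}^y$. Conventions: $e^{-\infty}=0$, and $x\cdot\infty=\infty\cdot x=\infty$ for $x\in(0,\infty]$. Under $0^+\cdot\infty$ one interprets $e^{-0\cdot\infty}=0$; under $0\cdot\infty^-$, $e^{-0\cdot\infty}=1$; under $\infty\cdot 0^+$, $e^{-\infty\cdot 0}=0$; under $\infty^-\cdot 0$, $e^{-\infty\cdot 0}=1$. In products the first factor refers to the $X$-variable and the second to the $Y$-variable. $X$ is in $(\star_1,\star_2)$-Laplace duality with $Y$ if $\mathbb{E}_x[e^{-X_ty}]=\mathbb{E}^y[e^{-xY_t}]$ for all $t\in[0,\infty)$, $(x,y)\in[0,\infty]^2$, under these conventions. Weak convergence is for probabilities on the compact space $[0,\infty]$. *)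

theory Defs
  imports "HOL-Probability.Probability"
begin

text \<open>
  The state space \<open>[0,\<infinity>]\<close> is \<^typ>\<open>ennreal\<close> with its order topology; the time set
  \<open>[0,\<infinity>)\<close> is the nonnegative part of \<^typ>\<open>real\<close> (values at negative times are irrelevant).
\<close>

definition natural_filtration ::
  "'a measure \<Rightarrow> (real \<Rightarrow> 'a \<Rightarrow> ennreal) \<Rightarrow> real \<Rightarrow> 'a measure" where
  "natural_filtration M X t =
     sigma (space M) {X u -` A \<inter> space M | u A. 0 \<le> u \<and> u \<le> t \<and> A \<in> sets borel}"

text \<open>
  \<open>M\<close> only provides the common measurable space; its measure is ignored. The measurability and
  Markov axioms speak about \<open>x \<mapsto> P\<^sub>x(X\<^sub>t \<in> A)\<close> and about
  \<open>P\<^sub>x(X\<^sub>t\<^sub>+\<^sub>s \<in> A | F\<^sub>t) = P\<^sub>y(X\<^sub>s \<in> A)\<close> at \<open>y = X\<^sub>t\<close>, almost surely under \<open>P\<^sub>x\<close>.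
\<close>

locale positive_markov_process =
  fixes M :: "'a measure"
    and P :: "ennreal \<Rightarrow> 'a measure"
    and X :: "real \<Rightarrow> 'a \<Rightarrow> ennreal"
  assumes prob_space_P: "\<And>x. prob_space (P x)"
    and sets_P: "\<And>x. sets (P x) = sets M"
    and measurable_X: "\<And>t. 0 \<le> t \<Longrightarrow> X t \<in> borel_measurable M"
    and borel_kernel: "\<And>t A. 0 \<le> t \<Longrightarrow> A \<in> sets borel \<Longrightarrow>
          (\<lambda>x. measure (P x) {\<omega> \<in> space M. X t \<omega> \<in> A}) \<in> borel_measurable borel"
    and start: "\<And>x. measure (P x) {\<omega> \<in> space M. X 0 \<omega> = x} = 1"
    and markov: "\<And>x s t A. 0 \<le> s \<Longrightarrow> 0 \<le> t \<Longrightarrow> A \<in> sets borel \<Longrightarrow>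
          AE \<omega> in P x.
            real_cond_exp (P x) (natural_filtration M X t) (\<lambda>\<omega>. indicator A (X (t + s) \<omega>)) \<omega>
              = measure (P (X t \<omega>)) {\<omega>' \<in> space M. X s \<omega>' \<in> A}"
begin

lemma subalgebra_natural_filtration: "subalgebra (P x) (natural_filtration M X t)"
proof -
  have sp: "space (P x) = space M"
    using sets_P by (rule sets_eq_imp_space_eq)
  let ?G = "{X u -` A \<inter> space M | u A. 0 \<le> u \<and> u \<le> t \<and> A \<in> sets borel}"
  have "?G \<subseteq> sets M"
    using measurable_X by (auto intro: measurable_sets)
  moreover have "?G \<subseteq> Pow (space M)"
    by auto
  ultimately show ?thesis
    unfolding subalgebra_def natural_filtration_def
    by (simp add: sp sets_P space_measure_of sets.sigma_sets_subset)
qed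

end

text \<open>The law of the process at time \<open>t\<close> under \<open>P\<^sub>x\<close>, as a probability on \<open>[0,\<infinity>]\<close>.\<close>

definition law_at :: "(ennreal \<Rightarrow> 'a measure) \<Rightarrow> (real \<Rightarrow> 'a \<Rightarrow> ennreal) \<Rightarrow> ennreal \<Rightarrow> real \<Rightarrow> ennreal measure" where
  "law_at P X x t = distr (P x) borel (X t)"

text \<open>
  The four conventions for the undefined products; in a product the first factor is the
  \<open>X\<close>-variable and the second one the \<open>Y\<close>-variable.
\<close>

datatype zero_infty_convention =
    Zero_plus_times_infty   (* 0^+ times infinity: exp (- 0 * infinity) = 0 *)
  | Zero_times_infty_minus  (* 0 times infinity^-: exp (- 0 * infinity) = 1 *)

datatype infty_zero_convention =
    Infty_times_zero_plus   (* infinity times 0^+: exp (- infinity * 0) = 0 *)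
  | Infty_minus_times_zero  (* infinity^- times 0: exp (- infinity * 0) = 1 *)

definition exp_neg :: "ennreal \<Rightarrow> real" where
  "exp_neg z = (if z = \<infinity> then 0 else exp (- enn2real z))"

text \<open>
  \<open>e\<^sup>-\<^sup>x\<^sup>y\<close> under the conventions. Outside the two exceptional points the product of
  \<^typ>\<open>ennreal\<close> is the intended one: \<open>z * \<infinity> = \<infinity> * z = \<infinity>\<close> for \<open>z \<noteq> 0\<close>.
\<close>

definition laplace_kernel ::
  "zero_infty_convention \<Rightarrow> infty_zero_convention \<Rightarrow> ennreal \<Rightarrow> ennreal \<Rightarrow> real" where
  "laplace_kernel c1 c2 x y =
     (if x = 0 \<and> y = \<infinity> then
        (case c1 of Zero_plus_times_infty \<Rightarrow> 0 | Zero_times_infty_minus \<Rightarrow> 1)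
      else if x = \<infinity> \<and> y = 0 then
        (case c2 of Infty_times_zero_plus \<Rightarrow> 0 | Infty_minus_times_zero \<Rightarrow> 1)
      else exp_neg (x * y))"

definition laplace_duality ::
  "zero_infty_convention \<Rightarrow> infty_zero_convention \<Rightarrow>
   (ennreal \<Rightarrow> 'a measure) \<Rightarrow> (real \<Rightarrow> 'a \<Rightarrow> ennreal) \<Rightarrow>
   (ennreal \<Rightarrow> 'b measure) \<Rightarrow> (real \<Rightarrow> 'b \<Rightarrow> ennreal) \<Rightarrow> bool" where
  "laplace_duality c1 c2 PX X PY Y \<longleftrightarrow>
     (\<forall>t\<ge>0. \<forall>x y.
        (\<integral>\<omega>. laplace_kernel c1 c2 (X t \<omega>) y \<partial>PX x) = (\<integral>\<omega>. laplace_kernel c1 c2 x (Y t \<omega>) \<partial>PY y))"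

text \<open>
  \<open>N\<close> is a probability on \<open>[0,\<infinity>]\<close> and \<open>\<mu> t\<close> converges weakly to \<open>N\<close> as \<open>t \<rightarrow> \<infinity>\<close>. Continuous
  test functions are automatically bounded, since \<open>[0,\<infinity>]\<close> is compact.
\<close>

definition weak_limit :: "(real \<Rightarrow> ennreal measure) \<Rightarrow> ennreal measure \<Rightarrow> bool" where
  "weak_limit \<mu> N \<longleftrightarrow>
     prob_space N \<and> sets N = sets borel \<and>
     (\<forall>f :: ennreal \<Rightarrow> real. continuous_on UNIV f \<longrightarrow>
        ((\<lambda>t. \<integral>v. f v \<partial>\<mu> t) \<longlongrightarrow> (\<integral>v. f v \<partial>N)) at_top)"

end

theory Submission
  imports Defs
begin

text \<open>
  For \<open>x, y \<in> (0,\<infinity>)\<close> no convention intervenes, and the duality reads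
  \<open>E\<^sub>x[exp (- y X\<^sub>t)] = E\<^sup>y[exp (- x Y\<^sub>t)]\<close>. The left side is the Laplace transform at \<open>y\<close> of the law
  of \<open>X\<^sub>t\<close>, the right side the Laplace transform at \<open>x\<close> of the law of \<open>Y\<^sub>t\<close>. The limit of the left
  side does not depend on \<open>x\<close> exactly when the limiting Laplace transform of \<open>Y\<^sub>t\<close> is constant
  on \<open>(0,\<infinity>)\<close>, and a constant \<open>c\<close> is the Laplace transform of \<open>c \<delta>\<^sub>0 + (1 - c) \<delta>\<^sub>\<infinity>\<close>: such laws
  are those carried by \<open>{0,\<infinity>}\<close>. Comparing the two limits gives the formula for the
  Laplace transform of \<open>\<nu>\<close>.

  What remains is that convergence of Laplace transforms amounts to weak convergence on the compact
  space \<open>[0,\<infinity>]\<close>. The map \<open>v \<mapsto> e\<^sup>-\<^sup>v\<close> is continuous and injective on \<open>[0,\<infinity>]\<close>, so by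
  Stone--Weierstrass the polynomials in \<open>e\<^sup>-\<^sup>v\<close> are dense among the continuous functions. Hence
  convergence of the Laplace transforms at the positive integers to those of a probability implies
  weak convergence (lemma \<open>weak_limit_if_moments\<close>). For the direction from \<open>Y\<close> to \<open>X\<close> the limit
  must also be constructed: Helly's selection theorem, applied to the laws of \<open>e\<^sup>-\<^sup>X\<close> on
  \<open>[0,1]\<close>, provides it (lemma \<open>limit_moments_realized\<close>).
\<close>

section \<open>The exponential on the extended half-line\<close>

lemma exp_neg_top [simp]: "exp_neg top = 0"
  by (simp add: exp_neg_def)

lemma exp_neg_ennreal: "0 \<le> r \<Longrightarrow> exp_neg (ennreal r) = exp (- r)"
  by (simp add: exp_neg_def)

lemma exp_neg_0 [simp]: "exp_neg 0 = 1"
  using exp_neg_ennreal[of 0] by simp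

lemma exp_neg_bounds: "0 \<le> exp_neg v" "exp_neg v \<le> 1"
  by (auto simp: exp_neg_def)

lemma exp_neg_add: "exp_neg (a + b) = exp_neg a * exp_neg b"
  by (cases a; cases b)
     (auto simp: exp_neg_ennreal exp_add[symmetric] simp flip: ennreal_plus)

lemma exp_neg_of_nat_mult: "exp_neg (of_nat n * v) = exp_neg v ^ n"
  by (induction n) (simp_all add: exp_neg_add distrib_right)

lemma inj_exp_neg: "inj exp_neg"
proof (rule injI)
  fix a b :: ennreal
  assume "exp_neg a = exp_neg b"
  then show "a = b"
    by (cases a; cases b) (auto simp: exp_neg_ennreal)
qed

lemma continuous_exp_neg: "continuous_on UNIV exp_neg"
proof (rule continuous_at_imp_continuous_on, rule ballI)
  fix a :: ennreal
  show "isCont exp_neg a"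
  proof (cases a)
    case (real r)
    have "eventually (\<lambda>v. v \<noteq> top) (nhds a)"
      using real by (intro t1_space_nhds) auto
    then have ev: "eventually (\<lambda>v. exp (- enn2real v) = exp_neg v) (at a)"
      unfolding eventually_at_filter by eventually_elim (auto simp: exp_neg_def)
    have "((\<lambda>v. enn2real v) \<longlongrightarrow> r) (at a)"
      using real by (intro tendsto_enn2real) (simp_all add: tendsto_ident_at)
    then have "((\<lambda>v. exp (- enn2real v)) \<longlongrightarrow> exp (- r)) (at a)"
      by (intro tendsto_exp tendsto_minus)
    then show ?thesis
      unfolding isCont_def tendsto_cong[OF ev] using real by (simp add: exp_neg_ennreal)
  next
    case top
    have "(exp_neg \<longlongrightarrow> 0) (at a)"
    proof (rule order_tendstoI)
      fix e :: real assume "e < 0"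
      then show "eventually (\<lambda>v. e < exp_neg v) (at a)"
        using exp_neg_bounds(1) by (auto intro!: always_eventually intro: less_le_trans)
    next
      fix e :: real assume e: "0 < e"
      define b where "b = max 0 (- ln e)"
      have b: "0 \<le> b" "- ln e \<le> b"
        by (simp_all add: b_def)
      have "eventually (\<lambda>v. ennreal b < v) (at a)"
        using top by (intro order_tendstoD(1)[OF tendsto_ident_at]) simp
      then show "eventually (\<lambda>v. exp_neg v < e) (at a)"
      proof eventually_elim
        case (elim v)
        show ?case
        proof (cases v)
          case (real s)
          then have "b < s"
            using elim b(1) by (simp add: ennreal_less_iff)
          then have "- s < ln e"
            using b(2) by simp
          then have "exp (- s) < exp (ln e)"
            by (subst exp_less_cancel_iff)
          then show ?thesis
            using real e by (simp add: exp_neg_ennreal)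
        qed (use e in simp)
      qed
    qed
    then show ?thesis
      unfolding isCont_def using top by simp
  qed
qed

lemma measurable_exp_neg [measurable]: "exp_neg \<in> borel_measurable borel"
  by (rule borel_measurable_continuous_onI[OF continuous_exp_neg])

lemma continuous_exp_neg_mult:
  assumes "c < top"
  shows "continuous_on UNIV (\<lambda>v. exp_neg (c * v))"
  by (rule continuous_on_compose2[OF continuous_exp_neg])
     (use assms in \<open>auto intro!: ennreal_continuous_on_cmult continuous_on_id\<close>)

text \<open>
  For \<open>x > 0\<close> the function \<open>v \<mapsto> exp (- x v)\<close> is the indicator of \<open>{0}\<close> on \<open>{0,\<infinity>}\<close>.
\<close>

lemma integral_exp_neg_carried_by_0_top:
  assumes "prob_space N" "sets N = sets borel" "measure N {0, top} = 1" "0 < x" "x < top"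
  shows "(\<integral>v. exp_neg (x * v) \<partial>N) = measure N {0}"
proof -
  interpret prob_space N by fact
  have "{0, top} \<in> events" "{0} \<in> events"
    using assms(2) by auto
  then have "AE v in N. v \<in> {0, top}"
    using assms(3) by (simp add: prob_eq_1)
  then have "(\<integral>v. exp_neg (x * v) \<partial>N) = (\<integral>v. indicator {0} v \<partial>N)"
    using assms by (intro integral_cong_AE) (auto simp: measurable_cong_sets[OF assms(2) refl] elim!: AE_mp)
  then show ?thesis
    using \<open>{0} \<in> events\<close> by simp
qed

section \<open>Weak convergence from convergence of moments\<close>

lemma polynomial_approximation_exp_neg:
  assumes "continuous_on UNIV f" "0 < e"
  obtains p where "\<And>v. \<bar>f v - poly p (exp_neg v)\<bar> < e"
proof -
  interpret function_ring_on "range (\<lambda>p v. poly p (exp_neg v))" UNIV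
  proof
    show "compact (UNIV :: ennreal set)"
      by (rule compact_UNIV)
    show "continuous_on UNIV g" if "g \<in> range (\<lambda>p v. poly p (exp_neg v))" for g
      using that by (auto intro!: continuous_intros continuous_exp_neg)
    show "(\<lambda>v. g v + h v) \<in> range (\<lambda>p v. poly p (exp_neg v))"
      if "g \<in> range (\<lambda>p v. poly p (exp_neg v))" "h \<in> range (\<lambda>p v. poly p (exp_neg v))" for g h
      using that by (auto simp flip: poly_add)
    show "(\<lambda>v. g v * h v) \<in> range (\<lambda>p v. poly p (exp_neg v))"
      if "g \<in> range (\<lambda>p v. poly p (exp_neg v))" "h \<in> range (\<lambda>p v. poly p (exp_neg v))" for g h
      using that by (auto simp flip: poly_mult)
    show "(\<lambda>_. c) \<in> range (\<lambda>p v. poly p (exp_neg v))" for c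
      by (rule range_eqI[of _ _ "[:c:]"]) simp
    show "\<exists>g\<in>range (\<lambda>p v. poly p (exp_neg v)). g x \<noteq> g y" if "x \<noteq> y" for x y
      using injD[OF inj_exp_neg, of x y] that
      by (intro bexI[OF _ range_eqI[of _ _ "[:0, 1:]"]]) auto
  qed
  show thesis
    using Stone_Weierstrass_basic[OF assms] that by auto
qed

lemma continuous_integrable_ennreal:
  fixes f :: "ennreal \<Rightarrow> real"
  assumes "prob_space N" "sets N = sets borel" "continuous_on UNIV f"
  shows "integrable N f"
proof -
  interpret prob_space N by fact
  obtain B where "\<And>v. norm (f v) \<le> B"
    using compact_imp_bounded[OF compact_continuous_image[OF assms(3) compact_UNIV]]
    by (auto simp: bounded_iff)
  moreover have "f \<in> borel_measurable N"
    using borel_measurable_continuous_onI[OF assms(3)] by (simp add: measurable_cong_sets[OF assms(2) refl])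
  ultimately show ?thesis
    by (intro integrable_const_bound[where B = B]) auto
qed

lemma integral_poly_exp_neg:
  assumes "prob_space N" "sets N = sets borel"
  shows "(\<integral>v. poly p (exp_neg v) \<partial>N) = (\<Sum>i\<le>degree p. coeff p i * (\<integral>v. exp_neg v ^ i \<partial>N))"
proof -
  have "integrable N (\<lambda>v. exp_neg v ^ i)" for i
    by (intro continuous_integrable_ennreal assms continuous_on_power continuous_exp_neg)
  then show ?thesis
    by (simp add: poly_altdef)
qed

lemma integral_diff_le_of_close:
  fixes f g :: "ennreal \<Rightarrow> real"
  assumes "prob_space N" "sets N = sets borel" "continuous_on UNIV f" "continuous_on UNIV g"
    and "\<And>v. \<bar>f v - g v\<bar> \<le> e"
  shows "\<bar>(\<integral>v. f v \<partial>N) - (\<integral>v. g v \<partial>N)\<bar> \<le> e"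
proof -
  interpret prob_space N by fact
  have int: "integrable N f" "integrable N g"
    by (intro continuous_integrable_ennreal assms)+
  have "\<bar>\<integral>v. f v - g v \<partial>N\<bar> \<le> (\<integral>v. \<bar>f v - g v\<bar> \<partial>N)"
    by (rule integral_abs_bound)
  also have "\<dots> \<le> (\<integral>v. e \<partial>N)"
    using int assms(5) by (intro integral_mono) auto
  finally show ?thesis
    using int by (simp add: prob_space)
qed

text \<open>
  Since \<open>exp_neg v ^ n = exp (- n v)\<close>, the hypothesis is convergence of the Laplace transforms at the
  positive integers. Negative times are excluded because the state variables need not be measurable
  there; the limit at \<open>\<infinity>\<close> does not see them.
\<close>

lemma weak_limit_if_moments:
  assumes mu: "\<And>t. 0 \<le> t \<Longrightarrow> prob_space (\<mu> t)" "\<And>t. 0 \<le> t \<Longrightarrow> sets (\<mu> t) = sets borel"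
    and N: "prob_space N" "sets N = sets borel"
    and lim: "\<And>n. 0 < n \<Longrightarrow> ((\<lambda>t. \<integral>v. exp_neg v ^ n \<partial>\<mu> t) \<longlongrightarrow> (\<integral>v. exp_neg v ^ n \<partial>N)) at_top"
  shows "weak_limit \<mu> N"
  unfolding weak_limit_def
proof (intro conjI allI impI N)
  fix f :: "ennreal \<Rightarrow> real" assume f: "continuous_on UNIV f"
  have nonneg: "eventually (\<lambda>t::real. 0 \<le> t) at_top"
    by (rule eventually_ge_at_top)
  have lim': "((\<lambda>t. \<integral>v. exp_neg v ^ n \<partial>\<mu> t) \<longlongrightarrow> (\<integral>v. exp_neg v ^ n \<partial>N)) at_top" for n
  proof (cases "n = 0")
    case True
    have "eventually (\<lambda>t. (\<integral>v. exp_neg v ^ n \<partial>\<mu> t) = (\<integral>v. exp_neg v ^ n \<partial>N)) at_top"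
      using nonneg by eventually_elim (simp add: True mu N prob_space.prob_space)
    then show ?thesis
      by (rule tendsto_eventually)
  qed (use lim in simp)
  have poly_lim: "((\<lambda>t. \<integral>v. poly p (exp_neg v) \<partial>\<mu> t) \<longlongrightarrow> (\<integral>v. poly p (exp_neg v) \<partial>N)) at_top" for p
  proof -
    have "eventually (\<lambda>t. (\<integral>v. poly p (exp_neg v) \<partial>\<mu> t)
        = (\<Sum>i\<le>degree p. coeff p i * (\<integral>v. exp_neg v ^ i \<partial>\<mu> t))) at_top"
      using nonneg by eventually_elim (rule integral_poly_exp_neg[OF mu])
    then show ?thesis
      unfolding integral_poly_exp_neg[OF N]
      by (subst tendsto_cong) (auto intro!: tendsto_intros lim')
  qed
  show "((\<lambda>t. \<integral>v. f v \<partial>\<mu> t) \<longlongrightarrow> (\<integral>v. f v \<partial>N)) at_top"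
  proof (rule tendstoI)
    fix e :: real assume "0 < e"
    then obtain p where p: "\<And>v. \<bar>f v - poly p (exp_neg v)\<bar> < e / 3"
      using polynomial_approximation_exp_neg[OF f, of "e / 3"] by auto
    have cont: "continuous_on UNIV (\<lambda>v. poly p (exp_neg v))"
      by (intro continuous_intros continuous_exp_neg)
    have close: "\<bar>(\<integral>v. f v \<partial>L) - (\<integral>v. poly p (exp_neg v) \<partial>L)\<bar> \<le> e / 3"
      if "prob_space L" "sets L = sets borel" for L
      using p by (intro integral_diff_le_of_close that f cont less_imp_le)
    have "eventually (\<lambda>t. dist (\<integral>v. poly p (exp_neg v) \<partial>\<mu> t) (\<integral>v. poly p (exp_neg v) \<partial>N) < e / 3) at_top"
      using tendstoD[OF poly_lim, of "e / 3"] \<open>0 < e\<close> by simp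
    then show "eventually (\<lambda>t. dist (\<integral>v. f v \<partial>\<mu> t) (\<integral>v. f v \<partial>N) < e) at_top"
      using nonneg
    proof eventually_elim
      case (elim t)
      then show ?case
        using close[OF mu[OF elim(2)]] close[OF N] unfolding dist_real_def by linarith
    qed
  qed
qed

text \<open>
  The probability is transported from a limit point \<open>M\<close> of the laws of \<open>exp_neg\<close> by \<open>u \<mapsto> - ln u\<close>,
  extended by \<open>\<infinity>\<close> for \<open>u \<le> 0\<close> and by \<open>0\<close> for \<open>u \<ge> 1\<close>. Composed with \<open>exp_neg\<close>, this extension is the
  retraction of the real line to \<open>[0,1]\<close>, so that it is not necessary to know that \<open>M\<close> is carried
  by \<open>[0,1]\<close>.
\<close>

lemma limit_moments_realized:
  fixes \<mu> :: "nat \<Rightarrow> ennreal measure"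
  assumes mu: "\<And>k. prob_space (\<mu> k)" "\<And>k. sets (\<mu> k) = sets borel"
    and lim: "\<And>n. 0 < n \<Longrightarrow> (\<lambda>k. \<integral>v. exp_neg v ^ n \<partial>\<mu> k) \<longlonglongrightarrow> m n"
  obtains N where "prob_space N" "sets N = sets borel"
    "\<And>n. 0 < n \<Longrightarrow> (\<integral>v. exp_neg v ^ n \<partial>N) = m n"
proof -
  define \<rho> where "\<rho> k = distr (\<mu> k) borel exp_neg" for k
  have meas: "exp_neg \<in> borel_measurable (\<mu> k)" for k
    by (simp add: measurable_cong_sets[OF mu(2) refl])
  have rd: "real_distribution (\<rho> k)" for k
    unfolding \<rho>_def by (intro prob_space.real_distribution_distr mu meas)
  have "tight \<rho>"
    unfolding tight_def
  proof (intro conjI allI impI rd)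
    fix e :: real assume "0 < e"
    have "measure (\<rho> k) {-1<..1} = 1" for k
    proof -
      interpret prob_space "\<mu> k" by (rule mu)
      have "exp_neg v \<in> {-1<..1}" for v
        using exp_neg_bounds[of v] by simp
      then have *: "exp_neg -` {-1<..1} \<inter> space (\<mu> k) = space (\<mu> k)"
        by auto
      show ?thesis
        unfolding \<rho>_def by (subst measure_distr[OF meas]) (simp_all add: * prob_space)
    qed
    then show "\<exists>a b. a < b \<and> (\<forall>n. 1 - e < measure (\<rho> n) {a<..b})"
      using \<open>0 < e\<close> by (intro exI[of _ "-1"] exI[of _ 1]) simp
  qed
  then obtain r M where r: "strict_mono (r :: nat \<Rightarrow> nat)" and M: "real_distribution M"
    and conv: "weak_conv_m (\<rho> \<circ> r) M"
    using tight_imp_convergent_subsubsequence[of \<rho> id] by (auto simp: strict_mono_id)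
  interpret M: real_distribution M by fact
  define clamp :: "real \<Rightarrow> real" where "clamp u = max 0 (min 1 u)" for u
  define \<phi> where "\<phi> u = (if u \<le> 0 then top else ennreal (- ln u))" for u
  have \<phi>: "exp_neg (\<phi> u) = clamp u" for u
    by (cases "u \<le> 1") (auto simp: \<phi>_def clamp_def exp_neg_ennreal ennreal_neg)
  have \<phi>_meas: "\<phi> \<in> borel_measurable M"
    unfolding \<phi>_def by measurable
  show thesis
  proof (rule that)
    show "prob_space (distr M borel \<phi>)"
      by (rule M.prob_space_distr[OF \<phi>_meas])
    show "(\<integral>v. exp_neg v ^ n \<partial>distr M borel \<phi>) = m n" if "0 < n" for n
    proof -
      have "(\<lambda>k. \<integral>u. clamp u ^ n \<partial>(\<rho> \<circ> r) k) \<longlonglongrightarrow> (\<integral>u. clamp u ^ n \<partial>M)"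
      proof (rule weak_conv_imp_integral_bdd_continuous_conv[OF _ M conv])
        show "real_distribution ((\<rho> \<circ> r) k)" for k
          by (simp add: rd)
        show "isCont (\<lambda>u. clamp u ^ n) u" for u
          unfolding clamp_def by (intro continuous_intros)
        show "norm (clamp u ^ n) \<le> 1" for u
          by (auto simp: clamp_def norm_power intro!: power_le_one)
      qed
      moreover have "(\<integral>u. clamp u ^ n \<partial>(\<rho> \<circ> r) k) = (\<integral>v. exp_neg v ^ n \<partial>\<mu> (r k))" for k
      proof -
        have "(\<integral>u. clamp u ^ n \<partial>(\<rho> \<circ> r) k) = (\<integral>v. clamp (exp_neg v) ^ n \<partial>\<mu> (r k))"
          unfolding \<rho>_def o_def clamp_def by (intro integral_distr meas) measurable
        then show ?thesis
          by (simp add: clamp_def exp_neg_bounds)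
      qed
      ultimately have "(\<lambda>k. \<integral>v. exp_neg v ^ n \<partial>\<mu> (r k)) \<longlonglongrightarrow> (\<integral>u. clamp u ^ n \<partial>M)"
        by simp
      moreover have "(\<lambda>k. \<integral>v. exp_neg v ^ n \<partial>\<mu> (r k)) \<longlonglongrightarrow> m n"
        using LIMSEQ_subseq_LIMSEQ[OF lim[OF that] r] by (simp add: o_def)
      ultimately have "(\<integral>u. clamp u ^ n \<partial>M) = m n"
        by (rule LIMSEQ_unique)
      moreover have "(\<integral>v. exp_neg v ^ n \<partial>distr M borel \<phi>) = (\<integral>u. exp_neg (\<phi> u) ^ n \<partial>M)"
        by (intro integral_distr \<phi>_meas) measurable
      ultimately show ?thesis
        by (simp add: \<phi>)
    qed
  qed simp
qed

section \<open>Laplace transforms of the laws of dual processes\<close>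

lemma (in positive_markov_process) measurable_X_P:
  assumes "0 \<le> t"
  shows "X t \<in> borel_measurable (P x)"
  using measurable_X[OF assms] by (simp add: measurable_cong_sets[OF sets_P refl])

lemma (in positive_markov_process) prob_space_law_at:
  assumes "0 \<le> t"
  shows "prob_space (law_at P X x t)"
  unfolding law_at_def by (intro prob_space.prob_space_distr prob_space_P measurable_X_P assms)

lemma sets_law_at: "sets (law_at P X x t) = sets borel"
  by (simp add: law_at_def)

lemma (in positive_markov_process) integral_law_at:
  fixes f :: "ennreal \<Rightarrow> real"
  assumes "0 \<le> t" "f \<in> borel_measurable borel"
  shows "(\<integral>v. f v \<partial>law_at P X x t) = (\<integral>\<omega>. f (X t \<omega>) \<partial>P x)"
  unfolding law_at_def by (intro integral_distr measurable_X_P assms)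

lemma laplace_law_at_dual:
  assumes "positive_markov_process MX PX X" "positive_markov_process MY PY Y"
    and "laplace_duality c1 c2 PX X PY Y"
    and "0 \<le> t" "x \<in> {0<..<\<infinity>}" "y \<in> {0<..<\<infinity>}"
  shows "(\<integral>v. exp_neg (y * v) \<partial>law_at PX X x t) = (\<integral>v. exp_neg (x * v) \<partial>law_at PY Y y t)"
proof -
  have "laplace_kernel c1 c2 v y = exp_neg (y * v)" "laplace_kernel c1 c2 x v = exp_neg (x * v)" for v
    using assms(5,6) by (auto simp: laplace_kernel_def mult.commute)
  moreover have "(\<integral>\<omega>. laplace_kernel c1 c2 (X t \<omega>) y \<partial>PX x) = (\<integral>\<omega>. laplace_kernel c1 c2 x (Y t \<omega>) \<partial>PY y)"
    using assms(3,4) by (simp add: laplace_duality_def)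
  ultimately show ?thesis
    using assms(4)
    by (simp add: positive_markov_process.integral_law_at[OF assms(1)]
          positive_markov_process.integral_law_at[OF assms(2)])
qed

lemma tendsto_laplace_dual:
  assumes "positive_markov_process MX PX X" "positive_markov_process MY PY Y"
    and "laplace_duality c1 c2 PX X PY Y" "x \<in> {0<..<\<infinity>}" "y \<in> {0<..<\<infinity>}"
  shows "((\<lambda>t. \<integral>v. exp_neg (y * v) \<partial>law_at PX X x t) \<longlongrightarrow> l) at_top
    \<longleftrightarrow> ((\<lambda>t. \<integral>v. exp_neg (x * v) \<partial>law_at PY Y y t) \<longlongrightarrow> l) at_top"
proof (rule tendsto_cong)
  show "eventually (\<lambda>t. (\<integral>v. exp_neg (y * v) \<partial>law_at PX X x t)
      = (\<integral>v. exp_neg (x * v) \<partial>law_at PY Y y t)) at_top"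
    using eventually_ge_at_top[of "0::real"]
    by eventually_elim (intro laplace_law_at_dual[OF assms(1-3) _ assms(4,5)])
qed

lemma tendsto_laplace_if_weak_limit:
  assumes "weak_limit \<mu> N" "y \<in> {0<..<\<infinity>}"
  shows "((\<lambda>t. \<integral>v. exp_neg (y * v) \<partial>\<mu> t) \<longlongrightarrow> (\<integral>v. exp_neg (y * v) \<partial>N)) at_top"
  using assms continuous_exp_neg_mult[of y] by (auto simp: weak_limit_def)

lemma of_nat_in_open_half_line: "0 < n \<Longrightarrow> (of_nat n :: ennreal) \<in> {0<..<\<infinity>}"
  by (simp add: ennreal_of_nat_eq_real_of_nat ennreal_less_top)

lemma weak_limit_law_at_if_laplace:
  assumes "positive_markov_process M P X" "prob_space N" "sets N = sets borel"
    and "\<And>y. y \<in> {0<..<\<infinity>} \<Longrightarrow>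
      ((\<lambda>t. \<integral>v. exp_neg (y * v) \<partial>law_at P X x t) \<longlongrightarrow> (\<integral>v. exp_neg (y * v) \<partial>N)) at_top"
  shows "weak_limit (law_at P X x) N"
  using assms(4)[OF of_nat_in_open_half_line]
  by (intro weak_limit_if_moments positive_markov_process.prob_space_law_at[OF assms(1)] sets_law_at
        assms(2,3)) (simp_all add: exp_neg_of_nat_mult)

lemma exists_prob_0_top:
  assumes "0 \<le> c" "c \<le> 1"
  obtains N where "prob_space N" "sets N = sets (borel :: ennreal measure)"
    "measure N {0, top} = 1" "measure N {0} = c"
proof -
  define N where "N = distr (bernoulli_pmf c) borel (\<lambda>b. if b then 0 else top :: ennreal)"
  have meas: "measure N A = measure (bernoulli_pmf c) ((\<lambda>b. if b then 0 else top) -` A)"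
    if "A \<in> sets borel" for A
    unfolding N_def using that by (subst measure_distr) auto
  show thesis
  proof (rule that)
    show "prob_space N"
      unfolding N_def by (intro measure_pmf.prob_space_distr) simp
    have "(\<lambda>b. if b then 0 else top :: ennreal) -` {0, top} = UNIV"
      by auto
    then show "measure N {0, top} = 1"
      by (simp add: meas)
    have "(\<lambda>b. if b then 0 else top :: ennreal) -` {0} = {True}"
      by (auto split: if_splits)
    then show "measure N {0} = c"
      using assms by (simp add: meas measure_pmf_single)
  qed (simp add: N_def)
qed

section \<open>The equivalence\<close>

theorem proposition3p27:
  fixes MX :: "'a measure" and PX :: "ennreal \<Rightarrow> 'a measure" and X :: "real \<Rightarrow> 'a \<Rightarrow> ennreal"
    and MY :: "'b measure" and PY :: "ennreal \<Rightarrow> 'b measure" and Y :: "real \<Rightarrow> 'b \<Rightarrow> ennreal"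
    and c1 :: zero_infty_convention and c2 :: infty_zero_convention
  assumes "positive_markov_process MX PX X"
    and "positive_markov_process MY PY Y"
    and "laplace_duality c1 c2 PX X PY Y"
  shows "((\<exists>\<nu>. \<forall>x\<in>{0<..<\<infinity>}. weak_limit (law_at PX X x) \<nu>) \<longleftrightarrow>
          (\<forall>y\<in>{0<..<\<infinity>}. \<exists>\<gamma>. weak_limit (law_at PY Y y) \<gamma> \<and> measure \<gamma> {0, \<infinity>} = 1)) \<and>
         (\<forall>\<nu> \<gamma>.
            (\<forall>x\<in>{0<..<\<infinity>}. weak_limit (law_at PX X x) \<nu>) \<and>
            (\<forall>y\<in>{0<..<\<infinity>}. weak_limit (law_at PY Y y) (\<gamma> y) \<and> measure (\<gamma> y) {0, \<infinity>} = 1) \<longrightarrow>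
            (\<forall>y\<in>{0<..<\<infinity>}. (\<integral>v. exp_neg (y * v) \<partial>\<nu>) = measure (\<gamma> y) {0}))"
proof (intro conjI iffI allI impI ballI)
  note dual = tendsto_laplace_dual[OF assms]
  have lim_Y: "((\<lambda>t. \<integral>v. exp_neg (y * v) \<partial>law_at PX X x t) \<longlongrightarrow> measure \<gamma> {0}) at_top"
    if "weak_limit (law_at PY Y y) \<gamma>" "measure \<gamma> {0, \<infinity>} = 1" "x \<in> {0<..<\<infinity>}" "y \<in> {0<..<\<infinity>}" for x y \<gamma>
    using tendsto_laplace_if_weak_limit[OF that(1,3)] that
      integral_exp_neg_carried_by_0_top[of \<gamma> x]
    by (simp add: dual weak_limit_def)
  {
    fix \<nu> \<gamma> and y :: ennreal
    assume "(\<forall>x\<in>{0<..<\<infinity>}. weak_limit (law_at PX X x) \<nu>) \<and>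
      (\<forall>y\<in>{0<..<\<infinity>}. weak_limit (law_at PY Y y) (\<gamma> y) \<and> measure (\<gamma> y) {0, \<infinity>} = 1)"
      and y: "y \<in> {0<..<\<infinity>}"
    \<comment> \<open>Any starting point of \<open>X\<close> in \<open>(0,\<infinity>)\<close> identifies the two limits; \<open>1\<close> is used.\<close>
    then have "weak_limit (law_at PX X 1) \<nu>" "weak_limit (law_at PY Y y) (\<gamma> y)" "measure (\<gamma> y) {0, \<infinity>} = 1"
      by auto
    from tendsto_unique[OF _ tendsto_laplace_if_weak_limit[OF this(1) y] lim_Y[OF this(2,3) _ y]]
    show "(\<integral>v. exp_neg (y * v) \<partial>\<nu>) = measure (\<gamma> y) {0}"
      by simp
  next
    fix y :: ennreal
    assume "\<exists>\<nu>. \<forall>x\<in>{0<..<\<infinity>}. weak_limit (law_at PX X x) \<nu>" and y: "y \<in> {0<..<\<infinity>}"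
    then obtain \<nu> where \<nu>: "\<And>x. x \<in> {0<..<\<infinity>} \<Longrightarrow> weak_limit (law_at PX X x) \<nu>"
      by blast
    define c where "c = (\<integral>v. exp_neg (y * v) \<partial>\<nu>)"
    have "prob_space \<nu>" "sets \<nu> = sets borel"
      using \<nu>[of 1] by (auto simp: weak_limit_def)
    then interpret prob_space \<nu>
      by simp
    have "integrable \<nu> (\<lambda>v. exp_neg (y * v))"
      using y \<open>prob_space \<nu>\<close> \<open>sets \<nu> = sets borel\<close>
      by (intro continuous_integrable_ennreal continuous_exp_neg_mult) auto
    then have "0 \<le> c" "c \<le> 1"
      using exp_neg_bounds by (auto simp: c_def intro!: integral_nonneg_AE integral_le_const)
    then obtain \<gamma> where \<gamma>: "prob_space \<gamma>" "sets \<gamma> = sets (borel :: ennreal measure)"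
      "measure \<gamma> {0, top} = 1" "measure \<gamma> {0} = c"
      by (rule exists_prob_0_top)
    have "weak_limit (law_at PY Y y) \<gamma>"
    proof (rule weak_limit_law_at_if_laplace[OF assms(2) \<gamma>(1,2)])
      fix x :: ennreal assume x: "x \<in> {0<..<\<infinity>}"
      then have "(\<integral>v. exp_neg (x * v) \<partial>\<gamma>) = c"
        using integral_exp_neg_carried_by_0_top[OF \<gamma>(1-3)] \<gamma>(4) by simp
      then show "((\<lambda>t. \<integral>v. exp_neg (x * v) \<partial>law_at PY Y y t) \<longlongrightarrow> (\<integral>v. exp_neg (x * v) \<partial>\<gamma>)) at_top"
        using tendsto_laplace_if_weak_limit[OF \<nu>[OF x] y] dual[OF x y] by (simp add: c_def)
    qed
    then show "\<exists>\<gamma>. weak_limit (law_at PY Y y) \<gamma> \<and> measure \<gamma> {0, \<infinity>} = 1"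
      using \<gamma>(3) by auto
  next
    assume "\<forall>y\<in>{0<..<\<infinity>}. \<exists>\<gamma>. weak_limit (law_at PY Y y) \<gamma> \<and> measure \<gamma> {0, \<infinity>} = 1"
    then obtain \<gamma> where "\<And>y. y \<in> {0<..<\<infinity>} \<Longrightarrow> weak_limit (law_at PY Y y) (\<gamma> y)"
      "\<And>y. y \<in> {0<..<\<infinity>} \<Longrightarrow> measure (\<gamma> y) {0, \<infinity>} = 1"
      by metis
    then have lim: "((\<lambda>t. \<integral>v. exp_neg (y * v) \<partial>law_at PX X x t) \<longlongrightarrow> measure (\<gamma> y) {0}) at_top"
      if "x \<in> {0<..<\<infinity>}" "y \<in> {0<..<\<infinity>}" for x y
      using lim_Y that by blast
    have moments: "((\<lambda>t. \<integral>v. exp_neg v ^ n \<partial>law_at PX X x t) \<longlongrightarrow> measure (\<gamma> (of_nat n)) {0}) at_top"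
      if "x \<in> {0<..<\<infinity>}" "0 < n" for x n
      using lim[OF that(1) of_nat_in_open_half_line[OF that(2)]] by (simp add: exp_neg_of_nat_mult)
    obtain \<nu> where \<nu>: "prob_space \<nu>" "sets \<nu> = sets borel"
      "\<And>n. 0 < n \<Longrightarrow> (\<integral>v. exp_neg v ^ n \<partial>\<nu>) = measure (\<gamma> (of_nat n)) {0}"
    proof (rule limit_moments_realized[of "\<lambda>k. law_at PX X 1 (real k)" "\<lambda>n. measure (\<gamma> (of_nat n)) {0}"])
      show "(\<lambda>k. \<integral>v. exp_neg v ^ n \<partial>law_at PX X 1 (real k)) \<longlonglongrightarrow> measure (\<gamma> (of_nat n)) {0}" if "0 < n" for n
        using filterlim_compose[OF moments[OF _ that] filterlim_real_sequentially, of 1] by simp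
    qed (simp_all add: sets_law_at positive_markov_process.prob_space_law_at[OF assms(1)])
    have "weak_limit (law_at PX X x) \<nu>" if "x \<in> {0<..<\<infinity>}" for x
      by (intro weak_limit_if_moments positive_markov_process.prob_space_law_at[OF assms(1)]
            sets_law_at \<nu>(1,2)) (simp_all add: \<nu>(3) moments[OF that])
    then show "\<exists>\<nu>. \<forall>x\<in>{0<..<\<infinity>}. weak_limit (law_at PX X x) \<nu>"
      by blast
  }
qed

end
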